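(* Let $f:\mathbb R^n\to\mathbb R$ be convex with locally Lipschitz continuous gradient, let $g:\mathbb R^n\to\mathbb R\cup\{\infty\}$ be proper, lsc and convex, and suppose that $\varphi:=f+g$ satisfies $\operatorname{argmin}\varphi\neq\emptyset$. Given $x^{-1}\in\mathbb R^n$ and $\gamma_0\ge\gamma_{-1}>0$, let $x^0=\operatorname{prox}_{\gamma_0g}(x^{-1}-\gamma_0\nabla f(x^{-1}))$ and, for $k=0,1,\dots$, let $$\gamma_{k+1}=\min\left\{\gamma_k\sqrt{1+\tfrac{\gamma_k}{\gamma_{k-1}}},\ \frac1{2L_k}\right\},\qquad L_k:=\frac{\|\nabla f(x^k)-\nabla f(x^{k-1})\|}{\|x^k-x^{k-1}\|},\qquad x^{k+1}=\operatorname{prox}_{\gamma_{k+1}g}\bigl(x^k-\gamma_{k+1}\nabla f(x^k)\bigr).$$ Then $(x^k)$ converges to a minimizer of $\varphi=f+g$.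
   Context: Norms are Euclidean. A differentiable $f:\mathbb R^n\to\mathbb R$ has locally Lipschitz continuous gradient if for every convex compact set $\mathcal V\subset\mathbb R^n$ there is $L_{f,\mathcal V}>0$ with $\|\nabla f(x)-\nabla f(x')\|\le L_{f,\mathcal V}\|x-x'\|$ for all $x,x'\in\mathcal V$. For $\tau>0$, $\operatorname{prox}_{\tau g}(x):=\operatorname{argmin}_{w}\{g(w)+\frac1{2\tau}\|w-x\|^2\}$. Conventions: $\frac00=0$ and $\frac10=\infty$ (so $\frac1{2L_k}=\infty$ if $L_k=0$). *)

theory Defs
  imports "HOL-Analysis.Analysis"
begin

definition grad :: "('a::euclidean_space \<Rightarrow> real) \<Rightarrow> 'a \<Rightarrow> 'a" where
  "grad f x = (THE D. GDERIV f x :> D)"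

definition locally_Lipschitz_gradient :: "('a::euclidean_space \<Rightarrow> real) \<Rightarrow> bool" where
  "locally_Lipschitz_gradient f \<longleftrightarrow>
     (\<forall>x. f differentiable (at x)) \<and>
     (\<forall>V. convex V \<and> compact V \<longrightarrow>
        (\<exists>L>0. \<forall>x\<in>V. \<forall>x'\<in>V. norm (grad f x - grad f x') \<le> L * norm (x - x')))"

text \<open>
  Functions with values in the reals extended by \<open>\<infinity>\<close> are rendered with type \<open>ereal\<close>;
  the value \<open>-\<infinity>\<close> is excluded by properness.
\<close>

definition proper_fun :: "('a \<Rightarrow> ereal) \<Rightarrow> bool" where
  "proper_fun g \<longleftrightarrow> (\<forall>x. g x \<noteq> -\<infinity>) \<and> (\<exists>x. g x \<noteq> \<infinity>)"

definition lsc_fun :: "('a::topological_space \<Rightarrow> ereal) \<Rightarrow> bool" where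
  "lsc_fun g \<longleftrightarrow> (\<forall>x. g x \<le> Liminf (at x) g)"

text \<open>The boundary cases \<open>u = 0\<close> and \<open>v = 0\<close> are harmless, since \<open>0 * \<infinity> = 0\<close> in \<open>ereal\<close>.\<close>

definition convex_fun :: "('a::real_vector \<Rightarrow> ereal) \<Rightarrow> bool" where
  "convex_fun g \<longleftrightarrow>
     (\<forall>x y u v. 0 \<le> u \<and> 0 \<le> v \<and> u + v = 1 \<longrightarrow>
        g (u *\<^sub>R x + v *\<^sub>R y) \<le> ereal u * g x + ereal v * g y)"

definition argmin :: "('a \<Rightarrow> ereal) \<Rightarrow> 'a set" where
  "argmin h = {w. is_arg_min h (\<lambda>_. True) w}"

text \<open>
  The proximal map is single-valued, for \<open>\<tau> > 0\<close> and \<open>g\<close> proper, lower semicontinuous and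
  convex; it then denotes the unique element of the set of minimizers.
\<close>

definition prox :: "real \<Rightarrow> ('a::real_normed_vector \<Rightarrow> ereal) \<Rightarrow> 'a \<Rightarrow> 'a" where
  "prox \<tau> g x = (THE w. w \<in> argmin (\<lambda>w. g w + ereal (1 / (2 * \<tau>) * (norm (w - x))\<^sup>2)))"

end

theory Submission
  imports Defs
begin

text \<open>
  For a minimizer \<open>w\<close>, the subgradient inequalities of \<open>g\<close> at three consecutive iterates and of \<open>f\<close>
  at the middle one show that the Lyapunov function \<open>U w\<close> below decreases along the iteration by at
  least a quarter of the squared length of the last step: the curvature bound
  \<open>\<gamma>\<^sub>k\<^sub>+\<^sub>1 L\<^sub>k \<le> 1/2\<close> absorbs the gradient differences, and the growth bound
  \<open>\<gamma>\<^sub>k\<^sub>+\<^sub>1\<^sup>2 \<le> \<gamma>\<^sub>k\<^sup>2 (1 + \<gamma>\<^sub>k / \<gamma>\<^sub>k\<^sub>-\<^sub>1)\<close>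
  makes the function value terms telescope. Hence the iterates are bounded, the gradient is Lipschitz along them, the stepsizes
  stay away from zero, and certain subgradients of \<open>f + g\<close> at the iterates tend to zero, so every cluster
  point is a minimizer. Only the distance term of \<open>U w\<close> depends on \<open>w\<close>, so the difference of the
  squared distances to two minimizers converges, which forces all cluster points to coincide.
\<close>

section \<open>Gradients and the tangent inequality of a convex function\<close>

lemma GDERIV_unique:
  assumes "GDERIV f x :> D" "GDERIV f x :> E"
  shows "D = E"
proof -
  have "(\<lambda>h. h \<bullet> D) = (\<lambda>h. h \<bullet> E)"
    using assms unfolding gderiv_def by (rule has_derivative_unique)
  then have "(D - E) \<bullet> D = (D - E) \<bullet> E" by meson
  then have "(D - E) \<bullet> (D - E) = 0" by (simp add: inner_diff_right)
  then show ?thesis by simp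
qed

text \<open>The adjoint of the derivative, evaluated at \<open>1\<close>, is its Riesz vector;
  uniqueness then makes the definite description in \<open>grad\<close> denote this vector.\<close>

lemma GDERIV_grad:
  fixes f :: "'a::euclidean_space \<Rightarrow> real"
  assumes "f differentiable (at x)"
  shows "GDERIV f x :> grad f x"
proof -
  obtain D where D: "(f has_derivative D) (at x)"
    using assms by (auto simp: differentiable_def)
  then have "linear D" by (rule has_derivative_linear)
  then have "D = (\<lambda>h. h \<bullet> adjoint D 1)"
    using adjoint_works[of D] by fastforce
  with D have "GDERIV f x :> adjoint D 1" by (simp add: gderiv_def)
  then show ?thesis
    unfolding grad_def using GDERIV_unique by (metis theI)
qed

text \<open>Restriction to the line through \<open>x\<close> and \<open>y\<close> reduces the claim
  to the one-dimensional tangent inequality at parameter 0, read at parameter 1.\<close>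

lemma convex_on_ge_tangent:
  assumes cvx: "convex_on UNIV f" and D: "GDERIV f x :> D"
  shows "f y \<ge> f x + D \<bullet> (y - x)"
proof -
  let ?h = "\<lambda>t::real. f (x + t *\<^sub>R (y - x))"
  have "convex_on UNIV ?h"
  proof (rule convex_onI)
    fix t a b :: real
    assume t: "0 < t" "t < 1"
    have "x + ((1 - t) *\<^sub>R a + t *\<^sub>R b) *\<^sub>R (y - x)
        = (1 - t) *\<^sub>R (x + a *\<^sub>R (y - x)) + t *\<^sub>R (x + b *\<^sub>R (y - x))"
      by (simp add: algebra_simps)
    then show "?h ((1 - t) *\<^sub>R a + t *\<^sub>R b) \<le> (1 - t) * ?h a + t * ?h b"
      using convex_onD[OF cvx, of t] t by simp
  qed simp
  moreover have "(?h has_real_derivative D \<bullet> (y - x)) (at 0)"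
  proof -
    have 1: "((\<lambda>t. x + t *\<^sub>R (y - x)) has_derivative (\<lambda>t. t *\<^sub>R (y - x))) (at 0)"
      by (auto intro!: derivative_eq_intros)
    have 2: "(f has_derivative (\<lambda>h. h \<bullet> D)) (at (x + 0 *\<^sub>R (y - x)))"
      using D by (simp add: gderiv_def)
    have "(?h has_derivative (\<lambda>t. (t *\<^sub>R (y - x)) \<bullet> D)) (at 0)"
      by (rule has_derivative_compose[OF 1 2])
    then show ?thesis
      by (simp add: has_field_derivative_def inner_commute mult_commute_abs)
  qed
  ultimately have "?h 1 - ?h 0 \<ge> (D \<bullet> (y - x)) * (1 - 0)"
    by (intro convex_on_imp_above_tangent[where A = UNIV]) auto
  then show ?thesis by simp
qed

section \<open>Lower semicontinuous functions: attained minima and a linear minorant\<close>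

lemma lsc_fun_eventually:
  assumes "lsc_fun g" "c < g x"
  shows "\<forall>\<^sub>F w in nhds x. c < g w"
proof -
  have "\<forall>\<^sub>F w in at x. c < g w"
    using assms less_LiminfD by (metis lsc_fun_def order_less_le_trans)
  then show ?thesis
    using assms(2) by (auto simp: eventually_nhds_conv_at)
qed

text \<open>A real \<open>r\<close> strictly between \<open>c - ereal (s w)\<close> and
  \<open>g w\<close> separates the summands: near \<open>w\<close>, \<open>g\<close> stays above
  \<open>r\<close> by semicontinuity and \<open>r + s\<close> stays above \<open>c\<close> by
  continuity.\<close>

lemma open_strict_superlevel_lsc_add:
  fixes g :: "'a::topological_space \<Rightarrow> ereal" and s :: "'a \<Rightarrow> real"
  assumes lsc: "lsc_fun g" and s: "continuous_on UNIV s"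
  shows "open {w. c < ereal (s w) + g w}"
proof (subst open_subopen, safe)
  fix w
  assume c: "c < ereal (s w) + g w"
  then have "c - ereal (s w) < g w"
    by (cases c; cases "g w") auto
  then obtain r where r: "c - ereal (s w) < ereal r" "ereal r < g w"
    using ereal_dense2 by blast
  then have "c < ereal (r + s w)"
    by (cases c) auto
  moreover have "((\<lambda>w. ereal (r + s w)) \<longlongrightarrow> ereal (r + s w)) (nhds w)"
  proof -
    have "(s \<longlongrightarrow> s w) (nhds w)"
      using s by (metis continuous_on_def UNIV_I tendsto_at_iff_tendsto_nhds)
    then show ?thesis by (intro tendsto_intros)
  qed
  ultimately have "\<forall>\<^sub>F y in nhds w. c < ereal (r + s y)"
    by (rule order_tendstoD(1)[rotated])
  moreover have "\<forall>\<^sub>F y in nhds w. ereal r < g y"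
    using lsc r(2) by (rule lsc_fun_eventually)
  ultimately have "\<forall>\<^sub>F y in nhds w. c < ereal (s y) + g y"
  proof eventually_elim
    case (elim y)
    then show ?case by (cases c; cases "g y") auto
  qed
  then show "\<exists>T. open T \<and> w \<in> T \<and> T \<subseteq> {w. c < ereal (s w) + g w}"
    unfolding eventually_nhds by blast
qed

text \<open>Without a minimizer the open sets \<open>{w. h y < h w}\<close> with \<open>y\<close> in
  \<open>K\<close> would cover \<open>K\<close>; in a finite subcover, the index with the least
  value lies in none of the sets.\<close>

lemma lsc_attains_min:
  fixes h :: "'a::topological_space \<Rightarrow> 'b::linorder"
  assumes K: "compact K" "K \<noteq> {}" and h: "\<And>c. open {w. c < h w}"
  shows "\<exists>p\<in>K. \<forall>w\<in>K. h p \<le> h w"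
proof (rule ccontr)
  assume "\<not> ?thesis"
  then have "K \<subseteq> (\<Union>y\<in>K. {w. h y < h w})"
    by (force simp: not_le)
  then obtain Y where Y: "Y \<subseteq> K" "finite Y" "K \<subseteq> (\<Union>y\<in>Y. {w. h y < h w})"
    using compactE_image[OF K(1), of K "\<lambda>y. {w. h y < h w}"] h by metis
  with K have "Y \<noteq> {}" by auto
  with Y(2) obtain p where "p \<in> Y" "\<forall>y\<in>Y. h p \<le> h y"
    using arg_min_if_finite[of Y h] by (metis not_le_imp_less)
  with Y show False by fastforce
qed

text \<open>
  Convexity along the segment from \<open>w0\<close> to \<open>w\<close> propagates the lower bound that \<open>g\<close> has on the unit
  ball around \<open>w0\<close>.
\<close>

lemma convex_fun_linear_minorant:
  fixes g :: "'a::euclidean_space \<Rightarrow> ereal"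
  assumes proper: "proper_fun g" and lsc: "lsc_fun g" and cvx: "convex_fun g"
    and fin: "g w0 = ereal a"
  obtains b where "b \<ge> 0" "\<And>w. norm (w - w0) \<ge> 1 \<Longrightarrow> ereal (- b * norm (w - w0)) \<le> g w"
proof -
  have "\<exists>p\<in>cball w0 1. \<forall>w\<in>cball w0 1. g p \<le> g w"
  proof (rule lsc_attains_min)
    show "open {w. c < g w}" for c
      using open_strict_superlevel_lsc_add[OF lsc, of "\<lambda>_. 0" c] by simp
  qed auto
  then obtain p where p: "\<And>w. w \<in> cball w0 1 \<Longrightarrow> g p \<le> g w" by blast
  have "g p \<le> ereal a" using p[of w0] fin by simp
  moreover have "g p \<noteq> -\<infinity>" using proper by (simp add: proper_fun_def)
  ultimately obtain m where m: "g p = ereal m" by (cases "g p") auto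
  show thesis
  proof
    show "\<bar>m\<bar> + \<bar>a\<bar> \<ge> 0" by simp
    fix w
    assume r: "norm (w - w0) \<ge> 1"
    \<comment> \<open>This places the point of the segment on the unit sphere around
      \<open>w0\<close>, where \<open>m\<close> bounds \<open>g\<close> from below.\<close>
    define t where "t = 1 / norm (w - w0)"
    have t: "0 < t" "t \<le> 1" using r by (auto simp: t_def divide_le_eq_1)
    show "ereal (- (\<bar>m\<bar> + \<bar>a\<bar>) * norm (w - w0)) \<le> g w"
    proof (cases "g w")
      case (real c)
      have "w0 + t *\<^sub>R (w - w0) \<in> cball w0 1"
        using r by (simp add: dist_norm t_def)
      moreover have "w0 + t *\<^sub>R (w - w0) = (1 - t) *\<^sub>R w0 + t *\<^sub>R w"
        by (simp add: algebra_simps)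
      ultimately have "g p \<le> ereal (1 - t) * g w0 + ereal t * g w"
        using p cvx t unfolding convex_fun_def
        by (metis (no_types, lifting) add.commute diff_add_cancel diff_ge_0_iff_ge less_eq_real_def order_trans)
      then have "m \<le> (1 - t) * a + t * c" by (simp add: m fin real)
      moreover have "(1 - t) * a \<le> \<bar>a\<bar>"
      proof -
        have "(1 - t) * a \<le> (1 - t) * \<bar>a\<bar>" using t by (intro mult_left_mono) auto
        also have "\<dots> \<le> 1 * \<bar>a\<bar>" using t by (intro mult_right_mono) auto
        finally show ?thesis by simp
      qed
      ultimately have "- (\<bar>m\<bar> + \<bar>a\<bar>) \<le> t * c" by linarith
      then have "- (\<bar>m\<bar> + \<bar>a\<bar>) * norm (w - w0) \<le> t * c * norm (w - w0)"
        by (rule mult_right_mono) simp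
      also have "\<dots> = c" using r by (auto simp: t_def)
      finally show ?thesis by (simp add: real)
    qed (use proper in \<open>auto simp: proper_fun_def\<close>)
  qed
qed

section \<open>The proximal map: existence, subgradient inequality, uniqueness\<close>

text \<open>The quadratic outgrows the linear minorant of \<open>g\<close>, so outside a large ball
  the objective is at least its value at \<open>w0\<close>; inside, compactness provides a
  minimum.\<close>

lemma prox_objective_attains_min:
  fixes g :: "'a::euclidean_space \<Rightarrow> ereal"
  assumes proper: "proper_fun g" and lsc: "lsc_fun g" and cvx: "convex_fun g"
    and \<tau>: "\<tau> > 0"
  shows "argmin (\<lambda>w. g w + ereal (1 / (2 * \<tau>) * (norm (w - x))\<^sup>2)) \<noteq> {}"
proof -
  define c where "c = 1 / (2 * \<tau>)"
  have c: "c > 0" using \<tau> by (simp add: c_def)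
  define h where "h w = ereal (c * (norm (w - x))\<^sup>2) + g w" for w
  obtain w0 where "g w0 \<noteq> \<infinity>" "g w0 \<noteq> -\<infinity>" using proper by (auto simp: proper_fun_def)
  then obtain a where a: "g w0 = ereal a" by (cases "g w0") auto
  obtain b where b: "b \<ge> 0" "\<And>w. norm (w - w0) \<ge> 1 \<Longrightarrow> ereal (- b * norm (w - w0)) \<le> g w"
    using convex_fun_linear_minorant[OF proper lsc cvx a] by metis
  define s where "s = norm (w0 - x)"
  \<comment> \<open>Chosen so that \<open>c * r - 2 * c * s - b\<close> is at least
    \<open>\<bar>a\<bar>\<close> for every \<open>r \<ge> R\<close>, while \<open>R \<ge> 1\<close>
    keeps the linear minorant available.\<close>
  define R where "R = 1 + (2 * c * s + b + \<bar>a\<bar>) / c"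
  have s: "s \<ge> 0" by (simp add: s_def)
  have R: "R \<ge> 1" "c * R \<ge> 2 * c * s + b + \<bar>a\<bar>"
    using c b s by (auto simp: R_def field_simps)
  have "\<exists>p\<in>cball w0 R. \<forall>w\<in>cball w0 R. h p \<le> h w"
  proof (rule lsc_attains_min)
    show "open {w. d < h w}" for d
      unfolding h_def by (intro open_strict_superlevel_lsc_add lsc continuous_intros)
  qed (use R in auto)
  then obtain p where p: "\<And>w. w \<in> cball w0 R \<Longrightarrow> h p \<le> h w" by blast
  have far: "h w0 \<le> h w" if "w \<notin> cball w0 R" for w
  proof -
    define r where "r = norm (w - w0)"
    have r: "r \<ge> 1" "r \<ge> R" using that R by (auto simp: r_def dist_norm norm_minus_commute)
    have "\<bar>r - s\<bar> \<le> norm (w - x)"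
      using norm_triangle_ineq3[of "w - w0" "x - w0"]
      by (simp add: r_def s_def norm_minus_commute)
    then have "\<bar>r - s\<bar>\<^sup>2 \<le> (norm (w - x))\<^sup>2" by (intro power_mono) auto
    then have q: "c * (r - s)\<^sup>2 \<le> c * (norm (w - x))\<^sup>2" using c by simp
    have "c * r \<ge> c * R" using r c by simp
    then have "c * r - 2 * c * s - b \<ge> \<bar>a\<bar>" using R by linarith
    \<comment> \<open>The left-hand side equals
      \<open>c * (r - s)\<^sup>2 - b * r - c * s\<^sup>2\<close>.\<close>
    then have "r * (c * r - 2 * c * s - b) \<ge> 1 * \<bar>a\<bar>"
      using r by (intro mult_mono) auto
    then have "c * s\<^sup>2 + a \<le> c * (r - s)\<^sup>2 - b * r"
      by (simp add: power2_eq_square algebra_simps)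
    with q have "ereal (c * s\<^sup>2 + a) \<le> ereal (c * (norm (w - x))\<^sup>2) + ereal (- b * r)"
      by simp
    also have "\<dots> \<le> h w"
      unfolding h_def using b(2)[of w] r by (intro add_left_mono) (simp add: r_def)
    finally show ?thesis by (simp add: h_def a s_def)
  qed
  have "h p \<le> h w" for w
    using p[of w] p[of w0] far[of w] R by (cases "w \<in> cball w0 R") (auto intro: order_trans)
  then have "is_arg_min h (\<lambda>_. True) p" by (auto simp: is_arg_min_def not_less)
  moreover have "h = (\<lambda>w. g w + ereal (1 / (2 * \<tau>) * (norm (w - x))\<^sup>2))"
    by (simp add: h_def c_def add.commute fun_eq_iff)
  ultimately show ?thesis by (auto simp: argmin_def)
qed

text \<open>Comparing \<open>p\<close> with the points of the segment towards \<open>y\<close> gives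
  the inequality up to an error linear in the parameter \<open>t\<close>, which vanishes as
  \<open>t\<close> tends to 0.\<close>

lemma prox_minimizer_subgradient:
  fixes g :: "'a::real_inner \<Rightarrow> ereal"
  assumes proper: "proper_fun g" and cvx: "convex_fun g" and \<tau>: "\<tau> > 0"
    and p: "p \<in> argmin (\<lambda>w. g w + ereal (1 / (2 * \<tau>) * (norm (w - x))\<^sup>2))"
  shows "\<bar>g p\<bar> \<noteq> \<infinity> \<and> (\<forall>y. g p + ereal (((1 / \<tau>) *\<^sub>R (x - p)) \<bullet> (y - p)) \<le> g y)"
proof -
  have min: "g p + ereal (1 / (2 * \<tau>) * (norm (p - x))\<^sup>2) \<le> g y + ereal (1 / (2 * \<tau>) * (norm (y - x))\<^sup>2)" for y
    using p by (auto simp: argmin_def is_arg_min_def not_less)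
  obtain w0 where "g w0 \<noteq> \<infinity>" "g w0 \<noteq> -\<infinity>" using proper by (auto simp: proper_fun_def)
  then have "g p \<noteq> \<infinity>" using min[of w0] by (cases "g w0") auto
  moreover have "g p \<noteq> -\<infinity>" using proper by (simp add: proper_fun_def)
  ultimately obtain a where a: "g p = ereal a" by (cases "g p") auto
  have "g p + ereal (((1 / \<tau>) *\<^sub>R (x - p)) \<bullet> (y - p)) \<le> g y" for y
  proof (cases "g y")
    case (real b)
    have *: "((1 / \<tau>) *\<^sub>R (x - p)) \<bullet> (y - p) + a - b \<le> t * ((norm (y - p))\<^sup>2 / (2 * \<tau>))"
      if t: "0 < t" "t < 1" for t
    proof -
      let ?w = "(1 - t) *\<^sub>R p + t *\<^sub>R y"
      have "g ?w \<le> ereal (1 - t) * g p + ereal t * g y"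
        using cvx t by (simp add: convex_fun_def)
      then have "g ?w \<le> ereal ((1 - t) * a + t * b)" by (simp add: a real)
      then have "g p + ereal (1 / (2 * \<tau>) * (norm (p - x))\<^sup>2)
          \<le> ereal ((1 - t) * a + t * b) + ereal (1 / (2 * \<tau>) * (norm (?w - x))\<^sup>2)"
        using min[of ?w] by (meson add_right_mono order_trans)
      then have "a + 1 / (2 * \<tau>) * (norm (p - x))\<^sup>2
          \<le> (1 - t) * a + t * b + 1 / (2 * \<tau>) * (norm (?w - x))\<^sup>2"
        by (simp add: a)
      moreover have "(norm (?w - x))\<^sup>2
          = (norm (p - x))\<^sup>2 + 2 * t * ((p - x) \<bullet> (y - p)) + t\<^sup>2 * (norm (y - p))\<^sup>2"
      proof -
        have "?w - x = (p - x) + t *\<^sub>R (y - p)" by (simp add: algebra_simps)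
        then show ?thesis
          by (simp only: power2_norm_eq_inner)
             (simp add: inner_add_left inner_add_right inner_commute power2_eq_square algebra_simps)
      qed
      moreover have "((1 / \<tau>) *\<^sub>R (x - p)) \<bullet> (y - p) = - ((p - x) \<bullet> (y - p)) / \<tau>"
        by (simp add: inner_diff_left diff_divide_distrib)
      ultimately have "t * (((1 / \<tau>) *\<^sub>R (x - p)) \<bullet> (y - p) + a - b)
          \<le> t * (t * ((norm (y - p))\<^sup>2 / (2 * \<tau>)))"
        using \<tau> by (simp only:) (simp add: field_simps power2_eq_square)
      then show ?thesis using t by (simp only: mult_le_cancel_left_pos)
    qed
    have "((1 / \<tau>) *\<^sub>R (x - p)) \<bullet> (y - p) + a - b \<le> 0 * ((norm (y - p))\<^sup>2 / (2 * \<tau>))"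
    proof (rule tendsto_lowerbound)
      show "((\<lambda>t. t * ((norm (y - p))\<^sup>2 / (2 * \<tau>))) \<longlongrightarrow> 0 * ((norm (y - p))\<^sup>2 / (2 * \<tau>))) (at_right 0)"
        by (intro tendsto_intros)
      show "\<forall>\<^sub>F t in at_right 0. ((1 / \<tau>) *\<^sub>R (x - p)) \<bullet> (y - p) + a - b \<le> t * ((norm (y - p))\<^sup>2 / (2 * \<tau>))"
        unfolding eventually_at_right_field using * by (intro exI[of _ 1]) simp
    qed simp
    then show ?thesis by (simp add: a real)
  qed (use proper in \<open>auto simp: proper_fun_def\<close>)
  then show ?thesis using a by simp
qed

text \<open>For two minimizers, the sum of their subgradient inequalities, each tested at the other
  point, forces their distance to be 0. Hence the description in \<open>prox\<close> denotes a
  minimizer.\<close>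

lemma prox_subgradient:
  fixes g :: "'a::euclidean_space \<Rightarrow> ereal"
  assumes "proper_fun g" "lsc_fun g" "convex_fun g" "\<tau> > 0"
  shows "\<bar>g (prox \<tau> g x)\<bar> \<noteq> \<infinity>"
    and "g (prox \<tau> g x) + ereal (((1 / \<tau>) *\<^sub>R (x - prox \<tau> g x)) \<bullet> (y - prox \<tau> g x)) \<le> g y"
proof -
  let ?A = "argmin (\<lambda>w. g w + ereal (1 / (2 * \<tau>) * (norm (w - x))\<^sup>2))"
  obtain p where p: "p \<in> ?A"
    using prox_objective_attains_min[OF assms] by blast
  have "q = p" if q: "q \<in> ?A" for q
  proof -
    note P = prox_minimizer_subgradient[OF assms(1,3,4) p]
    note Q = prox_minimizer_subgradient[OF assms(1,3,4) q]
    obtain a b where ab: "g p = ereal a" "g q = ereal b" using P Q by auto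
    have "a + ((1 / \<tau>) *\<^sub>R (x - p)) \<bullet> (q - p) \<le> b" "b + ((1 / \<tau>) *\<^sub>R (x - q)) \<bullet> (p - q) \<le> a"
      using P Q ab by (metis ereal_less_eq(3) plus_ereal.simps(1))+
    then have "((1 / \<tau>) *\<^sub>R (x - p)) \<bullet> (q - p) + ((1 / \<tau>) *\<^sub>R (x - q)) \<bullet> (p - q) \<le> 0"
      by linarith
    moreover have "((1 / \<tau>) *\<^sub>R (x - p)) \<bullet> (q - p) + ((1 / \<tau>) *\<^sub>R (x - q)) \<bullet> (p - q)
        = (1 / \<tau>) * ((q - p) \<bullet> (q - p))"
      using assms(4) by (simp add: field_simps inner_diff_left inner_diff_right inner_commute)
    ultimately have "(1 / \<tau>) * ((q - p) \<bullet> (q - p)) \<le> 0" by simp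
    then have "(q - p) \<bullet> (q - p) \<le> 0"
      using assms(4) by (simp add: divide_le_0_iff)
    then show ?thesis by (metis eq_iff_diff_eq_0 inner_ge_zero inner_eq_zero_iff order_antisym)
  qed
  with p have "prox \<tau> g x = p" unfolding prox_def by (rule the_equality)
  then show "\<bar>g (prox \<tau> g x)\<bar> \<noteq> \<infinity>"
    "g (prox \<tau> g x) + ereal (((1 / \<tau>) *\<^sub>R (x - prox \<tau> g x)) \<bullet> (y - prox \<tau> g x)) \<le> g y"
    using prox_minimizer_subgradient[OF assms(1,3,4) p] by auto
qed

section \<open>Convergence of bounded sequences from their cluster points\<close>

text \<open>If convergence to a cluster point \<open>z\<close> failed, some subsequence would stay
  away from \<open>z\<close>, and by boundedness it would have a cluster point different from
  \<open>z\<close>.\<close>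

lemma convergent_if_cluster_points_agree:
  fixes X :: "nat \<Rightarrow> 'a::heine_borel"
  assumes bdd: "bounded (range X)"
    and uniq: "\<And>r s y z. strict_mono r \<Longrightarrow> (X \<circ> r) \<longlonglongrightarrow> y \<Longrightarrow> strict_mono s \<Longrightarrow> (X \<circ> s) \<longlonglongrightarrow> z \<Longrightarrow> y = z"
  shows "\<exists>r z. strict_mono r \<and> (X \<circ> r) \<longlonglongrightarrow> z \<and> X \<longlonglongrightarrow> z"
proof -
  have sub: "\<exists>r z. strict_mono r \<and> (Y \<circ> r) \<longlonglongrightarrow> z" if "range Y \<subseteq> range X" for Y :: "nat \<Rightarrow> 'a"
    using bounded_imp_convergent_subsequence[OF bounded_subset[OF bdd that]] by blast
  obtain r z where r: "strict_mono r" "(X \<circ> r) \<longlonglongrightarrow> z" using sub[of X] by blast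
  have "X \<longlonglongrightarrow> z"
  proof (rule ccontr)
    assume "\<not> X \<longlonglongrightarrow> z"
    then obtain e where e: "e > 0" "\<not> (\<forall>\<^sub>F n in sequentially. dist (X n) z < e)"
      by (auto simp: tendsto_iff)
    then obtain s :: "nat \<Rightarrow> nat" where s: "strict_mono s" "\<And>n. \<not> dist (X (s n)) z < e"
      using not_eventually_sequentiallyD[OF e(2)] by auto
    obtain t y where t: "strict_mono t" "((X \<circ> s) \<circ> t) \<longlonglongrightarrow> y"
      using sub[of "X \<circ> s"] by (auto simp: image_comp[symmetric])
    have "(X \<circ> (s \<circ> t)) \<longlonglongrightarrow> y" using t(2) by (simp only: o_assoc)
    then have "y = z" using uniq[OF strict_mono_o[OF s(1) t(1)] _ r] by simp
    with t(2) e(1) have "\<forall>\<^sub>F n in sequentially. dist (X (s (t n))) z < e"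
      by (auto simp: tendsto_iff o_def)
    with s(2) show False by simp
  qed
  with r show ?thesis by blast
qed

text \<open>Along subsequences tending to \<open>y\<close> and to \<open>z\<close>, the difference
  of squared distances tends to minus and to plus the squared distance of \<open>y\<close> and
  \<open>z\<close>; a common limit forces \<open>y = z\<close>.\<close>

lemma Opial_convergence:
  fixes X :: "nat \<Rightarrow> 'a::euclidean_space"
  assumes bdd: "bounded (range X)"
    and clus: "\<And>r z. strict_mono r \<Longrightarrow> (X \<circ> r) \<longlonglongrightarrow> z \<Longrightarrow> z \<in> S"
    and conv: "\<And>y z. y \<in> S \<Longrightarrow> z \<in> S \<Longrightarrow> convergent (\<lambda>n. (norm (X n - y))\<^sup>2 - (norm (X n - z))\<^sup>2)"
  shows "\<exists>z\<in>S. X \<longlonglongrightarrow> z"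
proof -
  have uniq: "y = z" if r: "strict_mono r" "(X \<circ> r) \<longlonglongrightarrow> y" and s: "strict_mono s" "(X \<circ> s) \<longlonglongrightarrow> z" for r s y z
  proof -
    let ?D = "\<lambda>n. (norm (X n - y))\<^sup>2 - (norm (X n - z))\<^sup>2"
    obtain l where l: "?D \<longlonglongrightarrow> l"
      using conv[OF clus[OF r] clus[OF s]] unfolding convergent_def by blast
    have r': "(\<lambda>n. X (r n)) \<longlonglongrightarrow> y" and s': "(\<lambda>n. X (s n)) \<longlonglongrightarrow> z"
      using r(2) s(2) by (simp_all only: o_def)
    have "(\<lambda>n. ?D (r n)) \<longlonglongrightarrow> l" "(\<lambda>n. ?D (s n)) \<longlonglongrightarrow> l"
      using LIMSEQ_subseq_LIMSEQ[OF l r(1)] LIMSEQ_subseq_LIMSEQ[OF l s(1)] by (simp_all only: o_def)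
    moreover have "(\<lambda>n. ?D (r n)) \<longlonglongrightarrow> (norm (y - y))\<^sup>2 - (norm (y - z))\<^sup>2"
      by (intro tendsto_diff tendsto_power tendsto_norm tendsto_const r')
    moreover have "(\<lambda>n. ?D (s n)) \<longlonglongrightarrow> (norm (z - y))\<^sup>2 - (norm (z - z))\<^sup>2"
      by (intro tendsto_diff tendsto_power tendsto_norm tendsto_const s')
    ultimately have "l = (norm (y - y))\<^sup>2 - (norm (y - z))\<^sup>2" "l = (norm (z - y))\<^sup>2 - (norm (z - z))\<^sup>2"
      by (auto intro: LIMSEQ_unique)
    then have "2 * (norm (y - z))\<^sup>2 = 0" by (simp add: norm_minus_commute)
    then show ?thesis by simp
  qed
  have "\<exists>r z. strict_mono r \<and> (X \<circ> r) \<longlonglongrightarrow> z \<and> X \<longlonglongrightarrow> z"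
    by (rule convergent_if_cluster_points_agree[OF bdd]) (rule uniq)
  with clus show ?thesis by blast
qed

section \<open>The adaptive iteration and its Lyapunov inequality\<close>

text \<open>The stepsize rule is taken at index \<open>Suc n\<close> with the quotient L multiplied
  out, so that L = 0 needs no separate case. \<open>\<gamma>_lower\<close> records that a stepsize
  shrinks only when the curvature bound is active.\<close>

locale adaptive_prox_grad =
  fixes f :: "'a::euclidean_space \<Rightarrow> real" and f' :: "'a \<Rightarrow> 'a" and g :: "'a \<Rightarrow> ereal"
    and X :: "nat \<Rightarrow> 'a" and gX \<gamma> :: "nat \<Rightarrow> real" and m :: real
  assumes f_tangent: "f y + f' y \<bullet> (z - y) \<le> f z"
    and f_cont: "continuous_on UNIV f"
    and f'_lipschitz: "\<lbrakk>convex V; compact V\<rbrakk> \<Longrightarrow>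
          \<exists>L>0. \<forall>y\<in>V. \<forall>z\<in>V. norm (f' y - f' z) \<le> L * norm (y - z)"
    and g_lsc: "lsc_fun g"
    and gX: "g (X n) = ereal (gX n)"
    and step: "ereal (gX (Suc n) + ((1 / \<gamma> (Suc n)) *\<^sub>R (X n - X (Suc n)) - f' (X n)) \<bullet> (z - X (Suc n))) \<le> g z"
    and \<gamma>_pos: "\<gamma> n > 0"
    and \<gamma>_growth: "\<gamma> (Suc (Suc n)) \<le> \<gamma> (Suc n) * sqrt (1 + \<gamma> (Suc n) / \<gamma> n)"
    and \<gamma>_curv: "\<gamma> (Suc (Suc n)) * norm (f' (X n) - f' (X (Suc n))) \<le> norm (X n - X (Suc n)) / 2"
    and \<gamma>_lower: "\<gamma> (Suc n) \<le> \<gamma> (Suc (Suc n)) \<or>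
          X n \<noteq> X (Suc n) \<and> norm (X n - X (Suc n)) \<le> 2 * \<gamma> (Suc (Suc n)) * norm (f' (X n) - f' (X (Suc n)))"
    and min_le: "ereal m \<le> ereal (f z) + g z"
    and min_attained: "\<exists>w. ereal (f w) + g w = ereal m"
begin

text \<open>\<open>v n\<close> is a subgradient of \<open>f + g\<close> at \<open>X (Suc n)\<close>, by the optimality condition of the proximal step.\<close>

definition v :: "nat \<Rightarrow> 'a" where
  "v n = (1 / \<gamma> (Suc n)) *\<^sub>R (X n - X (Suc n)) - (f' (X n) - f' (X (Suc n)))"

definition P :: "nat \<Rightarrow> real" where
  "P n = f (X n) + gX n - m"

text \<open>With a and c the stepsizes at \<open>Suc n\<close> and \<open>Suc (Suc n)\<close>,
  \<open>\<gamma>_growth\<close> makes the weight of \<open>P n\<close> at least c^2/a, while the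
  weight of \<open>P (Suc n)\<close> one index later is c + c^2/a; so the value terms
  telescope.\<close>

definition U :: "'a \<Rightarrow> nat \<Rightarrow> real" where
  "U w n = (norm (X (Suc n) - w))\<^sup>2 / 2 + \<gamma> (Suc n) * (1 + \<gamma> (Suc n) / \<gamma> n) * P n
     + (norm (X n - X (Suc n)))\<^sup>2 / 2"

lemma step_real:
  assumes "g z = ereal b"
  shows "gX (Suc n) + (v n - f' (X (Suc n))) \<bullet> (z - X (Suc n)) \<le> b"
  using step[of n z] assms by (simp add: v_def)

lemma P_nonneg: "P n \<ge> 0"
  using min_le[of "X n"] by (simp add: gX P_def)

text \<open>The sum of the subgradient inequality of \<open>g\<close> and the tangent inequality of
  \<open>f\<close>, both at \<open>X (Suc n)\<close>.\<close>

lemma P_subgradient: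
  assumes "g z = ereal b"
  shows "P (Suc n) + v n \<bullet> (z - X (Suc n)) \<le> f z + b - m"
  using step_real[OF assms, of n] f_tangent[of "X (Suc n)" z]
  by (simp add: P_def inner_diff_left)

lemma f'_monotone: "(f' y - f' z) \<bullet> (y - z) \<ge> 0"
  using f_tangent[of y z] f_tangent[of z y] by (simp add: inner_diff_left inner_diff_right)

text \<open>
  Monotonicity of the subdifferential of \<open>g\<close> between \<open>X (Suc n)\<close> and \<open>X (Suc (Suc n))\<close> bounds the
  squared length of the step by the left-hand side; Cauchy--Schwarz then gives the claim.
\<close>

lemma v_inner_step:
  "\<gamma> (Suc (Suc n)) * (v n \<bullet> (X (Suc n) - X (Suc (Suc n)))) \<le> (\<gamma> (Suc (Suc n)))\<^sup>2 * (norm (v n))\<^sup>2"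
proof -
  define d where "d = X (Suc n) - X (Suc (Suc n))"
  define c where "c = \<gamma> (Suc (Suc n))"
  have c: "c > 0" by (simp add: c_def \<gamma>_pos)
  have "gX (Suc n) - (v n - f' (X (Suc n))) \<bullet> d \<le> gX (Suc (Suc n))"
    using step_real[OF gX, of n "Suc (Suc n)"] by (simp add: d_def inner_diff_right)
  moreover have "gX (Suc (Suc n)) + ((1 / c) *\<^sub>R d - f' (X (Suc n))) \<bullet> d \<le> gX (Suc n)"
    using step[of "Suc n" "X (Suc n)"] by (simp add: gX d_def c_def)
  ultimately have "(1 / c) * (d \<bullet> d) \<le> v n \<bullet> d" by (simp add: inner_diff_left)
  then have "d \<bullet> d \<le> c * (v n \<bullet> d)" using c by (simp add: field_simps)
  \<comment> \<open>Nonnegativity of this square takes the place of Cauchy--Schwarz: inserting the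
    bound on \<open>d \<bullet> d\<close> leaves a single copy of
    \<open>c * (v n \<bullet> d)\<close>.\<close>
  moreover have "(d - c *\<^sub>R v n) \<bullet> (d - c *\<^sub>R v n) = d \<bullet> d - 2 * c * (v n \<bullet> d) + c\<^sup>2 * (v n \<bullet> v n)"
    by (simp add: inner_diff_left inner_diff_right inner_commute power2_eq_square algebra_simps)
  moreover have "(d - c *\<^sub>R v n) \<bullet> (d - c *\<^sub>R v n) \<ge> 0" by simp
  ultimately show ?thesis
    unfolding d_def[symmetric] c_def[symmetric] power2_norm_eq_inner by linarith
qed

text \<open>In the expansion of the square of \<open>v n\<close>, the cross term with the gradient
  difference is dropped by monotonicity, \<open>v n \<bullet> e\<close> is at most the decrease of
  \<open>P\<close>, and \<open>\<gamma>_curv\<close> controls the squared gradient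
  difference.\<close>

lemma v_norm_bound:
  "(\<gamma> (Suc (Suc n)))\<^sup>2 * (norm (v n))\<^sup>2
     \<le> (\<gamma> (Suc (Suc n)))\<^sup>2 / \<gamma> (Suc n) * (P n - P (Suc n)) + (norm (X n - X (Suc n)))\<^sup>2 / 4"
proof -
  define e where "e = X n - X (Suc n)"
  define q where "q = f' (X n) - f' (X (Suc n))"
  define a where "a = \<gamma> (Suc n)"
  define c where "c = \<gamma> (Suc (Suc n))"
  have a: "a > 0" and c: "c > 0" by (simp_all add: a_def c_def \<gamma>_pos)
  have v: "v n = (1 / a) *\<^sub>R e - q" by (simp add: v_def e_def q_def a_def)
  have "v n \<bullet> v n = (1 / a) * (v n \<bullet> e) - (1 / a) * (q \<bullet> e) + q \<bullet> q"
    by (simp add: v inner_diff_left inner_diff_right inner_commute diff_divide_distrib)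
  moreover have "q \<bullet> e \<ge> 0" using f'_monotone by (simp add: q_def e_def)
  then have "(1 / a) * (q \<bullet> e) \<ge> 0" using a by simp
  moreover have "v n \<bullet> e \<le> P n - P (Suc n)"
    using P_subgradient[OF gX, of n n] by (simp add: e_def P_def)
  then have "(1 / a) * (v n \<bullet> e) \<le> (1 / a) * (P n - P (Suc n))"
    using a by (intro mult_left_mono) auto
  ultimately have "v n \<bullet> v n \<le> (1 / a) * (P n - P (Suc n)) + q \<bullet> q" by linarith
  then have "c\<^sup>2 * (v n \<bullet> v n) \<le> c\<^sup>2 * ((1 / a) * (P n - P (Suc n)) + q \<bullet> q)"
    by (intro mult_left_mono) auto
  moreover have "(c * norm q)\<^sup>2 \<le> (norm e / 2)\<^sup>2"
    using \<gamma>_curv[of n] c by (intro power_mono) (auto simp: c_def e_def q_def)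
  then have "c\<^sup>2 * (q \<bullet> q) \<le> (norm e)\<^sup>2 / 4"
    by (simp add: power_mult_distrib power_divide power2_norm_eq_inner)
  ultimately show ?thesis
    unfolding e_def[symmetric] a_def[symmetric] c_def[symmetric]
    by (simp add: power2_norm_eq_inner distrib_left)
qed

lemma U_decrease:
  assumes w: "ereal (f w) + g w = ereal m"
  shows "U w (Suc n) + (norm (X n - X (Suc n)))\<^sup>2 / 4 \<le> U w n"
proof -
  define x1 x2 where "x1 = X (Suc n)" and "x2 = X (Suc (Suc n))"
  define d where "d = x1 - x2"
  define e where "e = X n - x1"
  define a where "a = \<gamma> (Suc n)"
  define c where "c = \<gamma> (Suc (Suc n))"
  have a: "a > 0" and c: "c > 0" by (simp_all add: a_def c_def \<gamma>_pos)
  obtain b where b: "g w = ereal b" "f w + b = m" using w by (cases "g w") auto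
  have "gX (Suc (Suc n)) + ((1 / c) *\<^sub>R d - f' x1) \<bullet> (w - x2) \<le> b"
    using step[of "Suc n" w] by (simp add: b d_def c_def x1_def x2_def)
  moreover have "f x1 + f' x1 \<bullet> (w - x1) \<le> f w" by (rule f_tangent)
  moreover have "gX (Suc n) - (v n - f' x1) \<bullet> d \<le> gX (Suc (Suc n))"
    using step_real[OF gX, of n "Suc (Suc n)"] by (simp add: d_def x1_def x2_def inner_diff_right)
  \<comment> \<open>In the sum of the three inequalities both \<open>gX (Suc (Suc n))\<close> and
    all terms with \<open>f' x1\<close> cancel, since \<open>d = x1 - x2\<close>.\<close>
  ultimately have "P (Suc n) \<le> v n \<bullet> d - (1 / c) * (d \<bullet> (w - x2))"
    using b(2) by (simp add: P_def x1_def[symmetric] d_def inner_diff_left inner_diff_right diff_divide_distrib)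
  then have "c * P (Suc n) \<le> c * (v n \<bullet> d - (1 / c) * (d \<bullet> (w - x2)))"
    using c by (intro mult_left_mono) auto
  then have "c * P (Suc n) \<le> c * (v n \<bullet> d) - d \<bullet> (w - x2)"
    using c by (simp add: right_diff_distrib)
  \<comment> \<open>Turns the inner product into a difference of squared distances to
    \<open>w\<close>.\<close>
  moreover have "(norm (x1 - w))\<^sup>2 = (norm d)\<^sup>2 - 2 * (d \<bullet> (w - x2)) + (norm (x2 - w))\<^sup>2"
    by (simp add: d_def power2_norm_eq_inner inner_diff_left inner_diff_right inner_commute)
  moreover have "c * (v n \<bullet> d) \<le> c\<^sup>2 / a * (P n - P (Suc n)) + (norm e)\<^sup>2 / 4"
    using v_inner_step[of n] v_norm_bound[of n]
    by (simp add: c_def a_def d_def e_def x1_def x2_def)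
  \<comment> \<open>Only a quarter of the squared norm of \<open>e\<close> is spent here, out of the
    half contained in \<open>U w n\<close>; the rest is the claimed decrease.\<close>
  ultimately have main: "(norm (x2 - w))\<^sup>2 / 2 + (c + c\<^sup>2 / a) * P (Suc n) + (norm d)\<^sup>2 / 2
      \<le> (norm (x1 - w))\<^sup>2 / 2 + c\<^sup>2 / a * P n + (norm e)\<^sup>2 / 4"
    by (simp add: algebra_simps)
  have "c\<^sup>2 \<le> (a * sqrt (1 + a / \<gamma> n))\<^sup>2"
    using \<gamma>_growth[of n] c by (intro power_mono) (auto simp: c_def a_def)
  also have "\<dots> = a * (a * (1 + a / \<gamma> n))"
    using a \<gamma>_pos[of n] by (simp add: power_mult_distrib power2_eq_square)
  finally have "c\<^sup>2 / a \<le> a * (1 + a / \<gamma> n)"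
    using a by (simp add: field_simps)
  then have "c\<^sup>2 / a * P n \<le> a * (1 + a / \<gamma> n) * P n"
    using P_nonneg by (rule mult_right_mono)
  moreover have "c * (1 + c / a) = c + c\<^sup>2 / a"
    by (simp add: power2_eq_square distrib_left)
  ultimately show ?thesis
    using main unfolding U_def a_def[symmetric] c_def[symmetric] x1_def[symmetric] x2_def[symmetric]
      e_def[symmetric] d_def[symmetric] by simp
qed

section \<open>Boundedness, vanishing subgradients and convergence of the iterates\<close>

lemma dist_le_U: "(norm (X (Suc n) - w))\<^sup>2 / 2 \<le> U w n"
proof -
  have "\<gamma> (Suc n) * (1 + \<gamma> (Suc n) / \<gamma> n) * P n \<ge> 0"
    using \<gamma>_pos P_nonneg by (simp add: add_nonneg_nonneg less_imp_le)
  then show ?thesis by (simp add: U_def)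
qed

lemma U_nonneg: "U w n \<ge> 0"
  using dist_le_U[of n w] by (meson order_trans zero_le_divide_iff zero_le_numeral zero_le_power2)

lemma decseq_U:
  assumes "ereal (f w) + g w = ereal m"
  shows "decseq (U w)"
proof (rule decseq_SucI)
  show "U w (Suc n) \<le> U w n" for n
    using U_decrease[OF assms, of n] zero_le_power2[of "norm (X n - X (Suc n))"] by linarith
qed

lemma convergent_U:
  assumes "ereal (f w) + g w = ereal m"
  shows "convergent (U w)"
proof -
  have "Bseq (U w)" using decseq_bounded[OF decseq_U[OF assms]] U_nonneg by blast
  then show ?thesis using decseq_U[OF assms] by (simp add: Bseq_monoseq_convergent decseq_imp_monoseq)
qed

lemma bounded_X: "bounded (range X)"
proof -
  obtain w where w: "ereal (f w) + g w = ereal m" using min_attained by blast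
  have "norm (X (Suc n) - w) \<le> sqrt (2 * U w 0)" for n
  proof -
    have "U w n \<le> U w 0" using decseqD[OF decseq_U[OF w]] by simp
    then have "(norm (X (Suc n) - w))\<^sup>2 \<le> 2 * U w 0" using dist_le_U[of n w] by linarith
    then show ?thesis by (rule real_le_rsqrt)
  qed
  \<comment> \<open>\<open>U w n\<close> controls only \<open>X (Suc n)\<close>, so
    \<open>X 0\<close> is added by hand.\<close>
  then have "X n \<in> insert (X 0) (cball w (sqrt (2 * U w 0)))" for n
    by (cases n) (auto simp: dist_norm norm_minus_commute)
  then show ?thesis
    by (meson bounded_cball bounded_insert bounded_subset image_subsetI)
qed

text \<open>The squared increments are dominated by four times the consecutive differences of the
  convergent sequence \<open>U w\<close>.\<close>

lemma X_increments_tendsto_0: "(\<lambda>n. norm (X n - X (Suc n))) \<longlonglongrightarrow> 0"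
proof -
  obtain w where w: "ereal (f w) + g w = ereal m" using min_attained by blast
  obtain l where l: "U w \<longlonglongrightarrow> l" using convergent_U[OF w] by (auto simp: convergent_def)
  have "(\<lambda>n. 4 * (U w n - U w (Suc n))) \<longlonglongrightarrow> 4 * (l - l)"
    using l LIMSEQ_Suc[OF l] by (intro tendsto_intros)
  then have lim: "(\<lambda>n. 4 * (U w n - U w (Suc n))) \<longlonglongrightarrow> 0" by simp
  have "norm ((norm (X n - X (Suc n)))\<^sup>2) \<le> 4 * (U w n - U w (Suc n))" for n
    using U_decrease[OF w, of n] by simp
  then have "(\<lambda>n. (norm (X n - X (Suc n)))\<^sup>2) \<longlonglongrightarrow> 0"
    by (intro Lim_null_comparison[OF _ lim] always_eventually) blast
  then have "(\<lambda>n. sqrt ((norm (X n - X (Suc n)))\<^sup>2)) \<longlonglongrightarrow> sqrt 0"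
    by (rule tendsto_real_sqrt)
  then show ?thesis by simp
qed

text \<open>With a Lipschitz constant on a ball containing all iterates and a positive lower bound
  on the stepsizes, \<open>v n\<close> is bounded by a constant multiple of the increment.\<close>

lemma v_tendsto_0: "v \<longlonglongrightarrow> 0"
proof -
  obtain R where R: "\<And>n. norm (X n) \<le> R" using bounded_X by (auto simp: bounded_iff)
  obtain L where L: "L > 0" "\<And>y z. y \<in> cball 0 R \<Longrightarrow> z \<in> cball 0 R \<Longrightarrow> norm (f' y - f' z) \<le> L * norm (y - z)"
    using f'_lipschitz[OF convex_cball compact_cball] by blast
  have L': "norm (f' (X n) - f' (X (Suc n))) \<le> L * norm (X n - X (Suc n))" for n
    by (rule L(2)) (simp_all add: R)
  \<comment> \<open>\<open>\<gamma> 1\<close> starts the induction; \<open>1 / (2 * L)\<close>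
    bounds a stepsize at which the curvature bound is active.\<close>
  define \<epsilon> where "\<epsilon> = min (\<gamma> 1) (1 / (2 * L))"
  have \<epsilon>: "\<epsilon> > 0" using \<gamma>_pos L by (simp add: \<epsilon>_def)
  have \<gamma>_ge: "\<epsilon> \<le> \<gamma> (Suc n)" for n
  proof (induction n)
    case (Suc n)
    show ?case using \<gamma>_lower[of n]
    proof
      assume *: "X n \<noteq> X (Suc n) \<and> norm (X n - X (Suc n)) \<le> 2 * \<gamma> (Suc (Suc n)) * norm (f' (X n) - f' (X (Suc n)))"
      then have "1 * norm (X n - X (Suc n)) \<le> 2 * \<gamma> (Suc (Suc n)) * (L * norm (X n - X (Suc n)))"
        using order_trans[OF conjunct2[OF *] mult_left_mono[OF L']] \<gamma>_pos[of "Suc (Suc n)"] by simp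
      then have "1 * norm (X n - X (Suc n)) \<le> (2 * \<gamma> (Suc (Suc n)) * L) * norm (X n - X (Suc n))"
        by (simp only: mult.assoc)
      then have "1 \<le> 2 * \<gamma> (Suc (Suc n)) * L"
        by (rule mult_right_le_imp_le) (use * in simp)
      then have "1 / (2 * L) \<le> \<gamma> (Suc (Suc n))" using L(1) by (simp add: field_simps)
      then show ?thesis by (simp add: \<epsilon>_def)
    qed (use Suc in simp)
  qed (simp add: \<epsilon>_def)
  have "norm (v n) \<le> (1 / \<epsilon> + L) * norm (X n - X (Suc n))" for n
  proof -
    have "norm (v n) \<le> (1 / \<gamma> (Suc n)) * norm (X n - X (Suc n)) + norm (f' (X n) - f' (X (Suc n)))"
      using norm_triangle_ineq4[of "(1 / \<gamma> (Suc n)) *\<^sub>R (X n - X (Suc n))" "f' (X n) - f' (X (Suc n))"]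
        \<gamma>_pos[of "Suc n"] by (simp add: v_def)
    also have "\<dots> \<le> (1 / \<epsilon>) * norm (X n - X (Suc n)) + L * norm (X n - X (Suc n))"
    proof (rule add_mono[OF mult_right_mono L'])
      show "1 / \<gamma> (Suc n) \<le> 1 / \<epsilon>"
        using \<gamma>_ge[of n] \<epsilon> by (simp add: frac_le)
    qed simp
    finally show ?thesis by (simp add: distrib_right)
  qed
  moreover have "(\<lambda>n. (1 / \<epsilon> + L) * norm (X n - X (Suc n))) \<longlonglongrightarrow> 0"
    using X_increments_tendsto_0 by (rule tendsto_mult_right_zero)
  ultimately show ?thesis
    by (rule Lim_null_comparison[OF always_eventually[OF allI]])
qed

text \<open>Testing the subgradient \<open>v n\<close> at a minimizer bounds
  \<open>P (Suc n)\<close> by the norm of \<open>v n\<close> times a bounded distance.\<close>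

lemma P_tendsto_0: "P \<longlonglongrightarrow> 0"
proof -
  obtain w where w: "ereal (f w) + g w = ereal m" using min_attained by blast
  then obtain b where b: "g w = ereal b" "f w + b = m" by (cases "g w") auto
  obtain R where R: "\<And>n. norm (X n) \<le> R" using bounded_X by (auto simp: bounded_iff)
  have "norm (P (Suc n)) \<le> norm (v n) * (R + norm w)" for n
  proof -
    have "P (Suc n) \<le> v n \<bullet> (X (Suc n) - w)"
      using P_subgradient[OF b(1), of n] b(2) by (simp add: inner_diff_right)
    also have "\<dots> \<le> norm (v n) * norm (X (Suc n) - w)" by (rule norm_cauchy_schwarz)
    also have "\<dots> \<le> norm (v n) * (R + norm w)"
      using R[of "Suc n"] norm_triangle_ineq4[of "X (Suc n)" w] by (intro mult_left_mono) auto
    finally show ?thesis using P_nonneg by simp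
  qed
  moreover have "(\<lambda>n. norm (v n) * (R + norm w)) \<longlonglongrightarrow> 0"
    using v_tendsto_0 by (intro tendsto_mult_left_zero) (simp add: tendsto_norm_zero)
  ultimately have "(\<lambda>n. P (Suc n)) \<longlonglongrightarrow> 0"
    by (rule Lim_null_comparison[OF always_eventually[OF allI]])
  then show ?thesis by (rule LIMSEQ_imp_Suc)
qed

text \<open>If the value at \<open>z\<close> exceeded some \<open>c > m\<close>, semicontinuity
  would keep the values along the subsequence above \<open>c\<close>, against
  \<open>P_tendsto_0\<close>.\<close>

lemma cluster_point_minimizes:
  assumes r: "strict_mono r" and z: "(X \<circ> r) \<longlonglongrightarrow> z"
  shows "ereal (f z) + g z = ereal m"
proof (rule antisym)
  show "ereal (f z) + g z \<le> ereal m"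
  proof (rule ccontr)
    assume "\<not> ?thesis"
    then obtain c where c: "m < c" "ereal c < ereal (f z) + g z"
      by (metis ereal_dense2 ereal_less(2) less_ereal.simps(1) not_le)
    have "\<forall>\<^sub>F k in sequentially. (X \<circ> r) k \<in> {y. ereal c < ereal (f y) + g y}"
      using topological_tendstoD[OF z open_strict_superlevel_lsc_add[OF g_lsc f_cont]] c by simp
    moreover have "\<forall>\<^sub>F k in sequentially. P (r k) < c - m"
      using order_tendstoD(2)[OF LIMSEQ_subseq_LIMSEQ[OF P_tendsto_0 r]] c by simp
    ultimately have "\<forall>\<^sub>F k::nat in sequentially. False"
      by eventually_elim (auto simp: gX P_def)
    then show False by simp
  qed
qed (rule min_le)

theorem X_tendsto_minimizer: "\<exists>z. ereal (f z) + g z = ereal m \<and> X \<longlonglongrightarrow> z"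
proof -
  have "\<exists>z\<in>{w. ereal (f w) + g w = ereal m}. X \<longlonglongrightarrow> z"
  proof (rule Opial_convergence[OF bounded_X])
    fix y z
    assume yz: "y \<in> {w. ereal (f w) + g w = ereal m}" "z \<in> {w. ereal (f w) + g w = ereal m}"
    have "convergent (\<lambda>n. 2 * (U y n - U z n))"
      using convergent_U yz by (intro convergent_mult convergent_diff convergent_const) auto
    moreover have "2 * (U y n - U z n) = (norm (X (Suc n) - y))\<^sup>2 - (norm (X (Suc n) - z))\<^sup>2" for n
      by (simp add: U_def)
    \<comment> \<open>\<open>U\<close> measures distances from \<open>X (Suc n)\<close>, so the
      index is shifted by one.\<close>
    ultimately show "convergent (\<lambda>n. (norm (X n - y))\<^sup>2 - (norm (X n - z))\<^sup>2)"
      using convergent_Suc_iff[of "\<lambda>n. (norm (X n - y))\<^sup>2 - (norm (X n - z))\<^sup>2"] by simp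
  qed (use cluster_point_minimizes in simp)
  then show ?thesis by blast
qed

end

section \<open>The integer-indexed iteration as an instance of the abstract one\<close>

theorem corollary2p5:
  fixes f :: "real ^ 'n \<Rightarrow> real"
    and g :: "real ^ 'n \<Rightarrow> ereal"
    and \<phi> :: "real ^ 'n \<Rightarrow> ereal"
    and x :: "int \<Rightarrow> real ^ 'n"
    and \<gamma> L :: "int \<Rightarrow> real"
  assumes "convex_on UNIV f"
    and "locally_Lipschitz_gradient f"
    and "proper_fun g" and "lsc_fun g" and "convex_fun g"
    and "\<phi> = (\<lambda>z. ereal (f z) + g z)"
    and "argmin \<phi> \<noteq> {}"
    and "\<gamma> 0 \<ge> \<gamma> (-1)" and "\<gamma> (-1) > 0"
    and "x 0 = prox (\<gamma> 0) g (x (-1) - \<gamma> 0 *\<^sub>R grad f (x (-1)))"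
    \<comment> \<open>real division gives \<open>0 / 0 = 0\<close>, and \<open>1 / 0 = \<infinity>\<close> in \<open>ereal\<close>\<close>
    and "\<And>k. k \<ge> 0 \<Longrightarrow>
           L k = norm (grad f (x k) - grad f (x (k - 1))) / norm (x k - x (k - 1))"
    and "\<And>k. k \<ge> 0 \<Longrightarrow>
           ereal (\<gamma> (k + 1)) =
             min (ereal (\<gamma> k * sqrt (1 + \<gamma> k / \<gamma> (k - 1)))) (1 / (2 * ereal (L k)))"
    and "\<And>k. k \<ge> 0 \<Longrightarrow>
           x (k + 1) = prox (\<gamma> (k + 1)) g (x k - \<gamma> (k + 1) *\<^sub>R grad f (x k))"
  shows "\<exists>z \<in> argmin \<phi>. (\<lambda>k::nat. x (int k)) \<longlonglongrightarrow> z"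
proof -
  note cvx = assms(1) and Lip = assms(2) and g = assms(3-5) and L = assms(11) and \<gamma> = assms(12)
  let ?x = "\<lambda>n. x (int n)" and ?\<gamma> = "\<lambda>n. \<gamma> (int n)"
  have L_nonneg: "L k \<ge> 0" if "k \<ge> 0" for k using L[OF that] by simp
  \<comment> \<open>The two upper bounds given by the minimum, and that one of them is attained. For
    \<open>L k = 0\<close> the second argument is infinite, so the first one is the minimum.\<close>
  have \<gamma>_step: "\<gamma> (k + 1) \<le> \<gamma> k * sqrt (1 + \<gamma> k / \<gamma> (k - 1))" "\<gamma> (k + 1) * L k \<le> 1 / 2"
    "\<gamma> (k + 1) = \<gamma> k * sqrt (1 + \<gamma> k / \<gamma> (k - 1)) \<or> L k > 0 \<and> \<gamma> (k + 1) * L k = 1 / 2" if "k \<ge> 0" for k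
  proof -
    define s where "s = \<gamma> k * sqrt (1 + \<gamma> k / \<gamma> (k - 1))"
    have "\<gamma> (k + 1) \<le> s \<and> \<gamma> (k + 1) * L k \<le> 1 / 2 \<and> (\<gamma> (k + 1) = s \<or> L k > 0 \<and> \<gamma> (k + 1) * L k = 1 / 2)"
    proof (cases "L k = 0")
      case True
      then show ?thesis using \<gamma>[OF that] by (simp add: s_def divide_ereal_def flip: zero_ereal_def)
    next
      case False
      then have "1 / (2 * ereal (L k)) = ereal (1 / (2 * L k))"
        by (metis ereal_divide mult_eq_0_iff numeral_eq_ereal one_ereal_def times_ereal.simps(1) zero_neq_numeral)
      then have "\<gamma> (k + 1) = min s (1 / (2 * L k))"
        using \<gamma>[OF that] by (simp add: s_def min_def split: if_splits)
      moreover have "L k > 0" using False L_nonneg[OF that] by simp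
      ultimately show ?thesis by (simp add: min_def field_simps)
    qed
    then show "\<gamma> (k + 1) \<le> \<gamma> k * sqrt (1 + \<gamma> k / \<gamma> (k - 1))" "\<gamma> (k + 1) * L k \<le> 1 / 2"
      "\<gamma> (k + 1) = \<gamma> k * sqrt (1 + \<gamma> k / \<gamma> (k - 1)) \<or> L k > 0 \<and> \<gamma> (k + 1) * L k = 1 / 2"
      by (simp_all add: s_def)
  qed
  \<comment> \<open>Two consecutive stepsizes are carried because the growth bound involves
    both.\<close>
  have pos: "\<gamma> (int n - 1) > 0 \<and> \<gamma> (int n) > 0" for n
  proof (induction n)
    case (Suc n)
    then have "\<gamma> (int n) * sqrt (1 + \<gamma> (int n) / \<gamma> (int n - 1)) > 0"
      by (simp add: add_pos_pos)
    then have "\<gamma> (int n + 1) > 0"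
      using \<gamma>_step(3)[of "int n"] by (auto intro: zero_less_mult_pos2[of _ "L (int n)"])
    with Suc show ?case by (simp add: add.commute)
  qed (use assms(8,9) in simp)
  have \<gamma>_pos: "?\<gamma> n > 0" for n using pos by blast
  have sub: "\<bar>g (?x (Suc n))\<bar> \<noteq> \<infinity>"
    "g (?x (Suc n)) + ereal (((1 / ?\<gamma> (Suc n)) *\<^sub>R (?x n - ?x (Suc n)) - grad f (?x n)) \<bullet> (z - ?x (Suc n))) \<le> g z" for n z
  proof -
    have "?x (Suc n) = prox (?\<gamma> (Suc n)) g (?x n - ?\<gamma> (Suc n) *\<^sub>R grad f (?x n))"
      using assms(13)[of "int n"] by (simp add: add.commute)
    then have *: "\<bar>g (?x (Suc n))\<bar> \<noteq> \<infinity>"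
      "g (?x (Suc n)) + ereal (((1 / ?\<gamma> (Suc n)) *\<^sub>R (?x n - ?\<gamma> (Suc n) *\<^sub>R grad f (?x n) - ?x (Suc n))) \<bullet> (z - ?x (Suc n))) \<le> g z"
      using prox_subgradient[OF g \<gamma>_pos[of "Suc n"]] by metis+
    have eq: "(1 / ?\<gamma> (Suc n)) *\<^sub>R (?x n - ?\<gamma> (Suc n) *\<^sub>R grad f (?x n) - ?x (Suc n))
        = (1 / ?\<gamma> (Suc n)) *\<^sub>R (?x n - ?x (Suc n)) - grad f (?x n)"
      using \<gamma>_pos[of "Suc n"] by (simp add: algebra_simps)
    show "\<bar>g (?x (Suc n))\<bar> \<noteq> \<infinity>"
      "g (?x (Suc n)) + ereal (((1 / ?\<gamma> (Suc n)) *\<^sub>R (?x n - ?x (Suc n)) - grad f (?x n)) \<bullet> (z - ?x (Suc n))) \<le> g z"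
      using * unfolding eq by blast+
  qed
  have fin: "g (?x n) = ereal (real_of_ereal (g (?x n)))" for n
  proof -
    \<comment> \<open>The initial proximal step makes \<open>g\<close> finite already at
      \<open>x 0\<close>.\<close>
    have "\<bar>g (x 0)\<bar> \<noteq> \<infinity>"
      using prox_subgradient(1)[OF g \<gamma>_pos[of 0]] assms(10) by simp
    then have "\<bar>g (?x n)\<bar> \<noteq> \<infinity>" using sub(1) by (cases n) (auto simp del: of_nat_Suc)
    then show ?thesis by (simp add: ereal_real)
  qed
  \<comment> \<open>This holds also when the two iterates coincide, as both sides are then
    0.\<close>
  have qL: "norm (grad f (?x n) - grad f (?x (Suc n))) = L (int (Suc n)) * norm (?x n - ?x (Suc n))" for n
    using L[of "int (Suc n)"] by (simp add: norm_minus_commute)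
  obtain w where w: "\<And>z. \<phi> w \<le> \<phi> z"
    using assms(7) by (auto simp: argmin_def is_arg_min_def not_less)
  have "\<phi> w \<noteq> -\<infinity>" using g(1) by (simp add: assms(6) proper_fun_def)
  moreover have "\<phi> w \<noteq> \<infinity>" using w[of "x 0"] fin[of 0] by (auto simp: assms(6))
  ultimately obtain m where m: "\<phi> w = ereal m" by (cases "\<phi> w") auto
  interpret adaptive_prox_grad f "grad f" g ?x "\<lambda>n. real_of_ereal (g (?x n))" ?\<gamma> m
  proof
    have "GDERIV f y :> grad f y" for y
      using Lip GDERIV_grad by (auto simp: locally_Lipschitz_gradient_def)
    then show "f y + grad f y \<bullet> (z - y) \<le> f z" for y z
      using convex_on_ge_tangent[OF cvx] by blast
    show "continuous_on UNIV f"
      using Lip by (auto simp: locally_Lipschitz_gradient_def intro!: continuous_at_imp_continuous_on differentiable_imp_continuous_within)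
    show "\<exists>L>0. \<forall>y\<in>V. \<forall>z\<in>V. norm (grad f y - grad f z) \<le> L * norm (y - z)" if "convex V" "compact V" for V
      using Lip that by (auto simp: locally_Lipschitz_gradient_def)
    show "lsc_fun g" by (rule g)
    show "g (?x n) = ereal (real_of_ereal (g (?x n)))" for n by (rule fin)
    show "ereal (real_of_ereal (g (?x (Suc n))) + ((1 / ?\<gamma> (Suc n)) *\<^sub>R (?x n - ?x (Suc n)) - grad f (?x n)) \<bullet> (z - ?x (Suc n))) \<le> g z" for n z
      using sub(2)[of n z] fin[of "Suc n"] by (metis plus_ereal.simps(1))
    show "?\<gamma> n > 0" for n by (rule \<gamma>_pos)
    show "?\<gamma> (Suc (Suc n)) \<le> ?\<gamma> (Suc n) * sqrt (1 + ?\<gamma> (Suc n) / ?\<gamma> n)" for n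
      using \<gamma>_step(1)[of "int (Suc n)"] by (simp add: add.commute)
    have c: "?\<gamma> (Suc (Suc n)) = \<gamma> (int (Suc n) + 1)" for n by (simp add: add.commute)
    show "?\<gamma> (Suc (Suc n)) * norm (grad f (?x n) - grad f (?x (Suc n))) \<le> norm (?x n - ?x (Suc n)) / 2" for n
      using mult_right_mono[OF \<gamma>_step(2)[of "int (Suc n)"], of "norm (?x n - ?x (Suc n))"]
      unfolding qL c by (simp add: mult.assoc)
    show "?\<gamma> (Suc n) \<le> ?\<gamma> (Suc (Suc n)) \<or>
        ?x n \<noteq> ?x (Suc n) \<and> norm (?x n - ?x (Suc n)) \<le> 2 * ?\<gamma> (Suc (Suc n)) * norm (grad f (?x n) - grad f (?x (Suc n)))" for n
    proof -
      \<comment> \<open>The square root is at least 1, so the stepsize does not shrink when the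
        growth bound is attained.\<close>
      have "?\<gamma> (Suc n) * 1 \<le> ?\<gamma> (Suc n) * sqrt (1 + ?\<gamma> (Suc n) / ?\<gamma> n)"
        using \<gamma>_pos[of n] \<gamma>_pos[of "Suc n"] by (intro mult_left_mono) auto
      moreover have "?x n \<noteq> ?x (Suc n)" if "L (int (Suc n)) > 0"
        using that L[of "int (Suc n)"] by auto
      moreover have "norm (?x n - ?x (Suc n)) = 2 * (?\<gamma> (Suc (Suc n)) * L (int (Suc n))) * norm (?x n - ?x (Suc n))"
        if "?\<gamma> (Suc (Suc n)) * L (int (Suc n)) = 1 / 2"
        unfolding that by simp
      ultimately show ?thesis
        using \<gamma>_step(3)[of "int (Suc n)"] unfolding qL c by (auto simp: mult.assoc)
    qed
    show "ereal m \<le> ereal (f z) + g z" for z using w[of z] m by (simp add: assms(6))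
    show "\<exists>w. ereal (f w) + g w = ereal m" using m by (auto simp: assms(6))
  qed
  obtain z where z: "ereal (f z) + g z = ereal m" "?x \<longlonglongrightarrow> z"
    using X_tendsto_minimizer by blast
  then have "\<phi> z = \<phi> w" using m by (simp add: assms(6))
  then have "z \<in> argmin \<phi>" using w by (simp add: argmin_def is_arg_min_def not_less)
  with z(2) show ?thesis by blast
qed

end
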